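(* Let $n\ge 4$. The vertices of a regular $n$-gon centered about the origin are the only optimal configurations for $\pi_{n,n-2}^{\max}$; that is, a configuration $z_1,\dots,z_n\in\mathbb{C}$ with $\sum_{k=1}^n|z_k|=1$ and $\sum_{k=1}^n z_k=0$ attains the minimum $\pi_{n,n-2}^{\max}$ if and only if $z_1,\dots,z_n$ are, in some order, the vertices of a regular $n$-gon centered at the origin.
   Context: With $\binom{[n]}{n-2}$ the set of $(n-2)$-element subsets of $\{1,\dots,n\}$, $$\pi_{n,n-2}^{\max}:=\min\Big\{\max_{S\in\binom{[n]}{n-2}}\Big(\sum_{s\in S}|z_s|+\Big|\sum_{s\in S}z_s\Big|\Big) : z_1,\dots,z_n\in\mathbb{C},\ \sum_{k=1}^n|z_k|=1,\ \sum_{k=1}^n z_k=0\Big\}.$$ A configuration is optimal for $\pi_{n,n-2}^{\max}$ if it is feasible and attains this minimum. *)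

theory Defs
  imports "HOL-Analysis.Analysis"
begin

text \<open>A configuration \<open>z\<^sub>1, \<dots>, z\<^sub>n\<close> is a function \<open>z :: nat \<Rightarrow> complex\<close>, of which only the
  values on \<open>{1..n}\<close> are relevant.\<close>

definition feasible :: "nat \<Rightarrow> (nat \<Rightarrow> complex) \<Rightarrow> bool" where
  "feasible n z \<longleftrightarrow> (\<Sum>k=1..n. cmod (z k)) = 1 \<and> (\<Sum>k=1..n. z k) = 0"

definition max_value :: "nat \<Rightarrow> nat \<Rightarrow> (nat \<Rightarrow> complex) \<Rightarrow> real" where
  "max_value n k z =
     Max ((\<lambda>S. (\<Sum>s\<in>S. cmod (z s)) + cmod (\<Sum>s\<in>S. z s)) ` {S. S \<subseteq> {1..n} \<and> card S = k})"

text \<open>The minimum is written as an infimum of a set that is bounded below by 0; that it is attained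
  is expressed by the existence of an optimal configuration.\<close>

definition pi_max :: "nat \<Rightarrow> nat \<Rightarrow> real" where
  "pi_max n k = (INF z\<in>{z. feasible n z}. max_value n k z)"

definition optimal :: "nat \<Rightarrow> nat \<Rightarrow> (nat \<Rightarrow> complex) \<Rightarrow> bool" where
  "optimal n k z \<longleftrightarrow> feasible n z \<and> max_value n k z = pi_max n k"

definition regular_polygon_vertices :: "nat \<Rightarrow> complex set \<Rightarrow> bool" where
  "regular_polygon_vertices n P \<longleftrightarrow>
     (\<exists>r \<theta>. r > 0 \<and>
        P = (\<lambda>j. complex_of_real r * cis (\<theta> + 2 * pi * real j / real n)) ` {..<n})"

end

theory Submission
  imports Defs
begin

text \<open>
  Removing two entries \<open>z\<^sub>i, z\<^sub>j\<close> from a feasible configuration leaves a set \<open>S\<close> with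
  \<open>\<Sum>\<^sub>S |z\<^sub>s| = 1 - |z\<^sub>i| - |z\<^sub>j|\<close> and, because the total is 0, \<open>|\<Sum>\<^sub>S z\<^sub>s| = |z\<^sub>i + z\<^sub>j|\<close>. So the
  problem is to make the smallest triangle defect \<open>|z\<^sub>i| + |z\<^sub>j| - |z\<^sub>i + z\<^sub>j|\<close> over all pairs as large
  as possible (\<open>max_value_le_iff\<close>). For the regular \<open>n\<close>-gon that smallest defect is
  \<open>c = 2 (1 - cos (\<pi> / n)) / n\<close>, attained at neighbouring vertices.

  For the lower bound and uniqueness, suppose that all defects are at least \<open>c\<close>, and list the entries
  in the order of their arguments. Two consecutive entries of moduli \<open>a, b\<close> whose arguments differ
  by \<open>4 x\<close> have defect at most \<open>2 (a + b) sin\<^sup>2 x\<close>, with equality, when \<open>0 < x < \<pi> / 2\<close>, only for \<open>a = b\<close>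
  (\<open>triangle_defect_le\<close>). The \<open>n\<close> cyclic gaps satisfy \<open>\<Sum> x\<^sub>k = \<pi> / 2\<close> and the sums of neighbouring
  moduli add up to 2, so dividing by \<open>sin\<^sup>2 x\<^sub>k\<close> and summing gives
  \<open>\<Sum> (sin (\<pi> / 2n) / sin x\<^sub>k)\<^sup>2 \<le> n\<close>. As \<open>1 / sin\<^sup>2\<close> is strictly convex, Jensen's inequality forces
  all \<open>x\<^sub>k\<close> to be \<open>\<pi> / 2n\<close> (\<open>equal_angles\<close>); then all estimates are equalities, so
  neighbouring moduli agree and the entries form a regular \<open>n\<close>-gon (\<open>large_defects_imp_regular\<close>).

  This implication also yields the value of the minimum: a configuration that did better than
  the regular \<open>n\<close>-gon would have all defects above \<open>c\<close>, hence be a regular \<open>n\<close>-gon itself.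
\<close>

section \<open>Reduction to triangle defects\<close>

definition triangle_defect :: "complex \<Rightarrow> complex \<Rightarrow> real" where
  "triangle_defect a b = cmod a + cmod b - cmod (a + b)"

definition polygon_defect :: "nat \<Rightarrow> real" where
  "polygon_defect n = 2 * (1 - cos (pi / real n)) / real n"

lemma subsets_omitting_two:
  fixes A :: "'a set"
  assumes "finite A" "card A \<ge> 2"
  shows "{S. S \<subseteq> A \<and> card S = card A - 2} = {A - {i, j} | i j. i \<in> A \<and> j \<in> A \<and> i \<noteq> j}"
proof (intro equalityI subsetI)
  fix S assume "S \<in> {S. S \<subseteq> A \<and> card S = card A - 2}"
  then have S: "S \<subseteq> A" "card S = card A - 2" by auto
  then have "card (A - S) = 2"
    using assms by (simp add: card_Diff_subset finite_subset)
  then obtain i j where ij: "A - S = {i, j}" "i \<noteq> j" by (meson card_2_iff)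
  then have "S = A - {i, j}" using S(1) by blast
  then show "S \<in> {A - {i, j} | i j. i \<in> A \<and> j \<in> A \<and> i \<noteq> j}" using ij by blast
next
  fix S assume "S \<in> {A - {i, j} | i j. i \<in> A \<and> j \<in> A \<and> i \<noteq> j}"
  then obtain i j where "S = A - {i, j}" "i \<in> A" "j \<in> A" "i \<noteq> j" by blast
  then show "S \<in> {S. S \<subseteq> A \<and> card S = card A - 2}"
    using assms by (auto simp: card_Diff_subset)
qed

lemma value_omitting_two:
  assumes "feasible n z" "i \<in> {1..n}" "j \<in> {1..n}" "i \<noteq> j"
  shows "(\<Sum>s\<in>{1..n}-{i,j}. cmod (z s)) + cmod (\<Sum>s\<in>{1..n}-{i,j}. z s)
           = 1 - triangle_defect (z i) (z j)"
proof -
  have "(\<Sum>s\<in>{1..n}-{i,j}. cmod (z s)) = 1 - (cmod (z i) + cmod (z j))"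
    using assms by (simp add: sum_diff feasible_def)
  moreover have "(\<Sum>s\<in>{1..n}-{i,j}. z s) = - (z i + z j)"
    using assms by (simp add: sum_diff feasible_def)
  ultimately show ?thesis
    by (simp add: triangle_defect_def norm_minus_cancel del: minus_add_distrib)
qed

lemma max_value_le_iff:
  assumes "feasible n z" "n \<ge> 2"
  shows "max_value n (n - 2) z \<le> v \<longleftrightarrow>
    (\<forall>i\<in>{1..n}. \<forall>j\<in>{1..n}. i \<noteq> j \<longrightarrow> 1 - v \<le> triangle_defect (z i) (z j))"
proof -
  have *: "{S. S \<subseteq> {1..n} \<and> card S = n - 2}
      = {{1..n} - {i, j} | i j. i \<in> {1..n} \<and> j \<in> {1..n} \<and> i \<noteq> j}" (is "?F = ?G")
    using subsets_omitting_two[of "{1..n}"] assms(2) by simp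
  have "finite ?F" by simp
  moreover have "{1..n} - {1, 2} \<in> ?G" using assms(2) by force
  then have "?F \<noteq> {}" unfolding * by blast
  ultimately have "max_value n (n - 2) z \<le> v \<longleftrightarrow>
      (\<forall>S\<in>?F. (\<Sum>s\<in>S. cmod (z s)) + cmod (\<Sum>s\<in>S. z s) \<le> v)"
    unfolding max_value_def by simp
  also have "\<dots> \<longleftrightarrow> (\<forall>i\<in>{1..n}. \<forall>j\<in>{1..n}. i \<noteq> j \<longrightarrow>
      (\<Sum>s\<in>{1..n}-{i,j}. cmod (z s)) + cmod (\<Sum>s\<in>{1..n}-{i,j}. z s) \<le> v)"
    unfolding * by blast
  also have "\<dots> \<longleftrightarrow> (\<forall>i\<in>{1..n}. \<forall>j\<in>{1..n}. i \<noteq> j \<longrightarrow> 1 - triangle_defect (z i) (z j) \<le> v)"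
    using value_omitting_two[OF assms(1)] by (metis (no_types, lifting))
  finally show ?thesis by (simp add: algebra_simps)
qed

section \<open>The defect of two numbers in polar form\<close>

lemma norm_add_polar:
  "(cmod (of_real a * cis \<alpha> + of_real b * cis \<beta>))\<^sup>2
     = ((a + b) * cos ((\<beta> - \<alpha>) / 2))\<^sup>2 + ((a - b) * sin ((\<beta> - \<alpha>) / 2))\<^sup>2"
proof -
  define \<delta> \<mu> where "\<delta> = (\<beta> - \<alpha>) / 2" and "\<mu> = (\<beta> + \<alpha>) / 2"
  have *: "\<alpha> = \<mu> - \<delta>" "\<beta> = \<mu> + \<delta>" by (auto simp: \<delta>_def \<mu>_def field_simps)
  \<comment> \<open>Rotating by the mean argument turns the two numbers into \<open>a cis (-\<delta>)\<close> and \<open>b cis \<delta>\<close>.\<close>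
  have "of_real a * cis \<alpha> + of_real b * cis \<beta>
      = cis \<mu> * Complex ((a + b) * cos \<delta>) ((b - a) * sin \<delta>)"
    unfolding * by (auto simp: complex_eq_iff cos_add cos_diff sin_add sin_diff algebra_simps)
  then have "(cmod (of_real a * cis \<alpha> + of_real b * cis \<beta>))\<^sup>2
      = ((a + b) * cos \<delta>)\<^sup>2 + ((b - a) * sin \<delta>)\<^sup>2"
    by (simp add: norm_mult cmod_power2)
  then show ?thesis by (simp add: \<delta>_def power_mult_distrib power2_commute)
qed

lemma triangle_defect_equal_moduli:
  assumes "r \<ge> 0"
  shows "triangle_defect (of_real r * cis \<alpha>) (of_real r * cis \<beta>)
           = 2 * r * (1 - \<bar>cos ((\<beta> - \<alpha>) / 2)\<bar>)"
proof -
  have "(cmod (of_real r * cis \<alpha> + of_real r * cis \<beta>))\<^sup>2 = (2 * r * \<bar>cos ((\<beta> - \<alpha>) / 2)\<bar>)\<^sup>2"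
    unfolding norm_add_polar by (simp add: power_mult_distrib)
  then have "cmod (of_real r * cis \<alpha> + of_real r * cis \<beta>) = 2 * r * \<bar>cos ((\<beta> - \<alpha>) / 2)\<bar>"
    using assms by (subst (asm) power2_eq_iff_nonneg) auto
  then show ?thesis using assms by (simp add: triangle_defect_def norm_mult algebra_simps)
qed

text \<open>By \<open>norm_add_polar\<close>, the modulus of the sum is at least that of its component in the direction
  of the mean argument, and the excess comes from the component \<open>(a - b) sin ((\<beta> - \<alpha>) / 2)\<close>
  perpendicular to it. For fixed angles the defect is thus largest, given \<open>a + b\<close>, when \<open>a = b\<close>.\<close>

lemma triangle_defect_le:
  assumes "a \<ge> 0" "b \<ge> 0"
  shows "triangle_defect (of_real a * cis \<alpha>) (of_real b * cis \<beta>)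
           \<le> (a + b) * (1 - cos ((\<beta> - \<alpha>) / 2))"
    and "triangle_defect (of_real a * cis \<alpha>) (of_real b * cis \<beta>)
           = (a + b) * (1 - cos ((\<beta> - \<alpha>) / 2)) \<Longrightarrow> sin ((\<beta> - \<alpha>) / 2) \<noteq> 0 \<Longrightarrow> a = b"
proof -
  let ?m = "cmod (of_real a * cis \<alpha> + of_real b * cis \<beta>)"
  have d: "triangle_defect (of_real a * cis \<alpha>) (of_real b * cis \<beta>) = a + b - ?m"
    using assms by (simp add: triangle_defect_def norm_mult)
  have "((a + b) * cos ((\<beta> - \<alpha>) / 2))\<^sup>2 \<le> ?m\<^sup>2"
    unfolding norm_add_polar by simp
  then have "(a + b) * cos ((\<beta> - \<alpha>) / 2) \<le> ?m"
    using norm_ge_zero power2_le_imp_le by blast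
  then show "triangle_defect (of_real a * cis \<alpha>) (of_real b * cis \<beta>)
           \<le> (a + b) * (1 - cos ((\<beta> - \<alpha>) / 2))"
    unfolding d by (simp add: algebra_simps)
  assume "triangle_defect (of_real a * cis \<alpha>) (of_real b * cis \<beta>)
           = (a + b) * (1 - cos ((\<beta> - \<alpha>) / 2))" and s: "sin ((\<beta> - \<alpha>) / 2) \<noteq> 0"
  then have "?m = (a + b) * cos ((\<beta> - \<alpha>) / 2)"
    unfolding d by (simp add: algebra_simps)
  then have "((a - b) * sin ((\<beta> - \<alpha>) / 2))\<^sup>2 = 0"
    using norm_add_polar[of a \<alpha> b \<beta>] by simp
  then show "a = b" using s by simp
qed

section \<open>Jensen's inequality for the reciprocal squared sine\<close>

lemma sin_le_tangent:
  fixes x y :: real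
  assumes "0 \<le> x" "x \<le> pi" "0 \<le> y" "y \<le> pi"
  shows "sin x \<le> sin y + cos y * (x - y)"
proof -
  have "- cos y * (x - y) \<le> - sin x - (- sin y)"
  proof (rule f''_imp_f'[of "{0..pi}" _ _ sin])
    show "((\<lambda>t. - sin t) has_real_derivative - cos t) (at t)" for t :: real
      by (auto intro!: derivative_eq_intros)
    show "((\<lambda>t. - cos t) has_real_derivative sin t) (at t)" for t :: real
      by (auto intro!: derivative_eq_intros)
  qed (use assms in \<open>auto intro: sin_ge_zero\<close>)
  then show ?thesis by simp
qed

text \<open>The graph of \<open>1 / y\<^sup>2\<close> against its tangent at 1: strictness here is what makes the extremal
  configuration unique, while concavity of the sine is only used as an inequality.\<close>

lemma inverse_square_ge_tangent:
  fixes y :: real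
  assumes "y > 0"
  shows "3 - 2 * y \<le> 1 / y\<^sup>2"
    and "1 / y\<^sup>2 \<le> 3 - 2 * y \<Longrightarrow> y = 1"
proof -
  have *: "1 / y\<^sup>2 - (3 - 2 * y) = (y - 1)\<^sup>2 * (2 * y + 1) / y\<^sup>2"
    using assms by (simp add: field_simps power2_eq_square)
  then show "3 - 2 * y \<le> 1 / y\<^sup>2" using assms
    by (smt (verit, best) divide_nonneg_nonneg mult_nonneg_nonneg zero_le_power2)
  assume "1 / y\<^sup>2 \<le> 3 - 2 * y"
  then have "(y - 1)\<^sup>2 * (2 * y + 1) / y\<^sup>2 \<le> 0" using * by linarith
  then have "(y - 1)\<^sup>2 * (2 * y + 1) \<le> 0" using assms by (simp add: divide_le_0_iff)
  then have "(y - 1)\<^sup>2 \<le> 0" using assms by (smt (verit) mult_pos_pos)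
  then show "y = 1" by simp
qed

text \<open>The equality case of Jensen's inequality, in two steps: for the concave sine,
  \<open>\<Sum> sin x\<^sub>k \<le> n sin (\<pi> / 2n)\<close>; for the ratios \<open>y\<^sub>k = sin x\<^sub>k / sin (\<pi> / 2n)\<close>, the tangent of \<open>1 / y\<^sup>2\<close> at
  1 gives \<open>\<Sum> 1 / y\<^sub>k\<^sup>2 \<ge> \<Sum> (3 - 2 y\<^sub>k) \<ge> n\<close>.\<close>

lemma equal_angles:
  fixes x :: "nat \<Rightarrow> real"
  assumes n: "n \<ge> 2"
    and x: "\<And>k. k < n \<Longrightarrow> 0 < x k" "(\<Sum>k<n. x k) = pi / 2"
    and le: "(\<Sum>k<n. (sin (pi / (2 * n)) / sin (x k))\<^sup>2) \<le> n"
    and k: "k < n"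
  shows "x k = pi / (2 * n)"
proof -
  define x0 s0 where "x0 = pi / (2 * n)" and "s0 = sin x0"
  have x0: "0 < x0" "x0 \<le> pi / 2" using n by (auto simp: x0_def field_simps)
  have s0: "s0 > 0" unfolding s0_def using x0 by (intro sin_gt_zero) auto
  have xle: "x j \<le> pi / 2" if "j < n" for j
  proof -
    have "x j \<le> (\<Sum>k<n. x k)"
      using that x(1) by (intro member_le_sum) (auto intro: less_imp_le)
    then show ?thesis using x(2) by simp
  qed
  define y where "y j = sin (x j) / s0" for j
  have ypos: "y j > 0" if "j < n" for j
    unfolding y_def using that x(1)[OF that] xle[OF that] s0
    by (intro divide_pos_pos sin_gt_zero) auto
  have "(\<Sum>j<n. sin (x j)) \<le> (\<Sum>j<n. s0 + cos x0 * (x j - x0))"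
    unfolding s0_def using x(1) xle x0
    by (intro sum_mono sin_le_tangent) (auto intro: less_imp_le order_trans[OF xle])
  also have "\<dots> = n * s0 + cos x0 * (pi / 2 - n * x0)"
    by (simp add: sum.distrib sum_subtractf x(2) flip: sum_distrib_left)
  also have "\<dots> = n * s0" using n by (simp add: x0_def)
  finally have ysum: "(\<Sum>j<n. y j) \<le> n"
    using s0 by (simp add: y_def field_simps flip: sum_divide_distrib)
  have "(\<Sum>j<n. 1 / (y j)\<^sup>2 - (3 - 2 * y j)) = (\<Sum>j<n. 1 / (y j)\<^sup>2) - (3 * n - 2 * (\<Sum>j<n. y j))"
    by (simp add: sum_subtractf sum_distrib_left)
  also have "\<dots> \<le> 0"
    using le ysum by (simp add: y_def s0_def x0_def power_divide)
  finally have "(\<Sum>j<n. 1 / (y j)\<^sup>2 - (3 - 2 * y j)) \<le> 0" .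
  moreover have nn: "1 / (y j)\<^sup>2 - (3 - 2 * y j) \<ge> 0" if "j < n" for j
    using inverse_square_ge_tangent(1)[OF ypos[OF that]] by simp
  moreover have "1 / (y k)\<^sup>2 - (3 - 2 * y k) \<le> (\<Sum>j<n. 1 / (y j)\<^sup>2 - (3 - 2 * y j))"
    using k nn by (intro member_le_sum) auto
  ultimately have "1 / (y k)\<^sup>2 \<le> 3 - 2 * y k" by linarith
  then have "y k = 1" using inverse_square_ge_tangent(2) ypos[OF k] by blast
  then have "sin (x k) = sin x0" using s0 by (simp add: y_def s0_def)
  then have "x k = x0"
    using x0 x(1)[OF k] xle[OF k] sin_inj_pi[of "x k" x0] by simp
  then show ?thesis by (simp add: x0_def)
qed

section \<open>Configurations whose defects are all large\<close>

lemma one_minus_cos_eq: "1 - cos (x :: real) = 2 * (sin (x / 2))\<^sup>2"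
  using cos_double_sin[of "x / 2"] by simp

text \<open>Here the gaps \<open>u\<^sub>k\<^sub>+\<^sub>1 - u\<^sub>k = 4 x\<^sub>k\<close> add up to \<open>2 \<pi>\<close>, so that \<open>\<Sum> x\<^sub>k = \<pi> / 2\<close>, and \<open>equal_angles\<close>
  applies once the defect bounds are divided by \<open>sin\<^sup>2 x\<^sub>k\<close>. Equal angles turn the defect bounds into
  \<open>a\<^sub>k + a\<^sub>k\<^sub>+\<^sub>1 \<ge> 2 / n\<close>; these sums total 2, so each bound is an equality, and the equality case
  of \<open>triangle_defect_le\<close> makes neighbouring moduli equal.
  The index \<open>n\<close> repeats the index 0 after a full turn, so that the \<open>n\<close> consecutive pairs close up
  cyclically.\<close>

lemma cyclic_large_defects:
  fixes a u :: "nat \<Rightarrow> real"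
  assumes n: "n \<ge> 2"
    and a: "\<And>k. k \<le> n \<Longrightarrow> a k \<ge> 0" "a n = a 0" "(\<Sum>k<n. a k) = 1"
    and u: "\<And>k. k < n \<Longrightarrow> u k \<le> u (Suc k)" "u n = u 0 + 2 * pi"
    and d: "\<And>k. k < n \<Longrightarrow> polygon_defect n
      \<le> triangle_defect (of_real (a k) * cis (u k)) (of_real (a (Suc k)) * cis (u (Suc k)))"
    and k: "k \<le> n"
  shows "a k = 1 / n" "u k = u 0 + 2 * pi * k / n"
proof -
  define x where "x j = (u (Suc j) - u j) / 4" for j
  define m where "m j = a j + a (Suc j)" for j
  define s0 where "s0 = sin (pi / (2 * n))"
  have s0: "s0 > 0" unfolding s0_def using n by (intro sin_gt_zero) (auto simp: field_simps)
  have c: "polygon_defect n = 4 * s0\<^sup>2 / n"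
    by (simp add: polygon_defect_def one_minus_cos_eq s0_def mult.commute)
  have xsum: "(\<Sum>j<n. x j) = pi / 2"
    using sum_lessThan_telescope[of u n] u(2)
    by (simp add: x_def flip: sum_divide_distrib)
  have msum: "(\<Sum>j<n. m j) = 2"
    using sum_lessThan_telescope[of a n] a(2,3) unfolding m_def sum.distrib sum_subtractf by simp
  have bound: "2 * s0\<^sup>2 / n \<le> m j * (sin (x j))\<^sup>2" if "j < n" for j
  proof -
    have "4 * s0\<^sup>2 / n \<le> m j * (1 - cos ((u (Suc j) - u j) / 2))"
      using d[OF that] triangle_defect_le(1)[of "a j" "a (Suc j)" "u j" "u (Suc j)"] a(1) that
      unfolding m_def c[symmetric] by force
    then show ?thesis by (simp add: one_minus_cos_eq x_def)
  qed
  have sin2: "(sin (x j))\<^sup>2 > 0" if "j < n" for j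
  proof -
    have "2 * s0\<^sup>2 / n > 0" using s0 n by simp
    then have "m j * (sin (x j))\<^sup>2 > 0" using bound[OF that] by linarith
    then show ?thesis by (auto simp: zero_less_mult_iff)
  qed
  have xpos: "x j > 0" if "j < n" for j
    using sin2[OF that] u(1)[OF that] by (cases "x j = 0") (auto simp: x_def)
  have mge: "2 / n * (s0 / sin (x j))\<^sup>2 \<le> m j" if "j < n" for j
    using bound[OF that] sin2[OF that] n by (simp add: field_simps power_divide)
  have "2 / n * (\<Sum>j<n. (s0 / sin (x j))\<^sup>2) \<le> (\<Sum>j<n. m j)"
    unfolding sum_distrib_left using mge by (intro sum_mono) auto
  then have "(\<Sum>j<n. (s0 / sin (x j))\<^sup>2) \<le> n"
    using msum n by (simp add: field_simps)
  then have xeq: "x j = pi / (2 * n)" if "j < n" for j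
    using equal_angles[of n x j] n xpos xsum that unfolding s0_def by blast
  then have ustep: "u (Suc j) = u j + 2 * pi / n" if "j < n" for j
    using xeq[OF that] by (simp add: x_def field_simps)
  have m2: "m j \<ge> 2 / n" if "j < n" for j
    using mge[OF that] xeq[OF that] s0 by (simp add: s0_def)
  have meq: "m j = 2 / n" if "j < n" for j
  proof -
    have "m j - 2 / n \<le> (\<Sum>j<n. m j - 2 / n)"
      using that m2 by (intro member_le_sum) auto
    also have "\<dots> = 0" using msum n by (simp add: sum_subtractf)
    finally show ?thesis using m2[OF that] by simp
  qed
  have astep: "a (Suc j) = a j" if "j < n" for j
  proof -
    have half: "(u (Suc j) - u j) / 2 = pi / n" using ustep[OF that] by simp
    have "triangle_defect (of_real (a j) * cis (u j)) (of_real (a (Suc j)) * cis (u (Suc j)))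
        = (a j + a (Suc j)) * (1 - cos ((u (Suc j) - u j) / 2))"
    proof (rule antisym)
      have "(a j + a (Suc j)) * (1 - cos ((u (Suc j) - u j) / 2)) = polygon_defect n"
        using meq[OF that] unfolding half m_def by (simp add: polygon_defect_def)
      then show "(a j + a (Suc j)) * (1 - cos ((u (Suc j) - u j) / 2))
        \<le> triangle_defect (of_real (a j) * cis (u j)) (of_real (a (Suc j)) * cis (u (Suc j)))"
        using d[OF that] by simp
    qed (use a(1) that in \<open>intro triangle_defect_le(1); simp\<close>)
    moreover have "sin (pi / n) > 0" using n by (intro sin_gt_zero) (auto simp: field_simps)
    then have "sin ((u (Suc j) - u j) / 2) \<noteq> 0" unfolding half by simp
    ultimately show ?thesis
      using triangle_defect_le(2)[of "a j" "a (Suc j)" "u j" "u (Suc j)"] a(1) that by simp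
  qed
  have aconst: "a j = a 0" if "j \<le> n" for j
    using that by (induction j) (auto simp: astep)
  have "(\<Sum>j<n. a j) = (\<Sum>j<n. a 0)"
    by (intro sum.cong refl aconst) simp
  then have "n * a 0 = 1" using a(3) by simp
  then have "a 0 = 1 / n" using n by (simp add: nonzero_eq_divide_eq mult.commute)
  then show "a k = 1 / n" using aconst[OF k] by (rule trans[rotated])
  show "u k = u 0 + 2 * pi * k / n"
    using k
  proof (induction k)
    case (Suc j)
    then show ?case using ustep[of j] n by (simp add: field_simps)
  qed simp
qed

lemma inj_on_polygon:
  assumes "r > 0"
  shows "inj_on (\<lambda>j. complex_of_real r * cis (\<theta> + 2 * pi * real j / real n)) {..<n}"
proof (cases "n = 0")
  case False
  then have "inj_on (\<lambda>j. cis (2 * pi * real j / real n)) {..<n}"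
    using Complex.bij_betw_roots_unity[of n] by (auto simp: bij_betw_def)
  then show ?thesis
    using assms by (auto simp: inj_on_def cis_mult[symmetric])
qed auto

text \<open>Sorting the entries by argument and appending the first one, turned by \<open>2 \<pi>\<close>, gives the cyclic
  sequence of the preceding analysis. Gaps larger than \<open>\<pi>\<close> need no separate treatment, since the
  defect bound by half the gap holds for all angles.\<close>

lemma large_defects_imp_regular:
  assumes "feasible n z" and n: "n \<ge> 2"
    and d: "\<And>i j. i \<in> {1..n} \<Longrightarrow> j \<in> {1..n} \<Longrightarrow> i \<noteq> j \<Longrightarrow>
      polygon_defect n \<le> triangle_defect (z i) (z j)"
  shows "\<exists>P. regular_polygon_vertices n P \<and> bij_betw z {1..n} P"
proof -
  define t where "t k = Arg2pi (z k)" for k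
  define xs where "xs = sort_key t [1..<Suc n]"
  have xs: "length xs = n" "distinct xs" "set xs = {1..n}" "sorted (map t xs)"
    by (auto simp: xs_def)
  have bij: "bij_betw ((!) xs) {..<n} {1..n}"
    using bij_betw_nth[OF xs(2)] xs(1,3) by blast
  define p where "p k = xs ! (if k < n then k else 0)" for k
  define a where "a k = cmod (z (p k))" for k
  define u where "u k = t (p k) + (if k < n then 0 else 2 * pi)" for k
  have zp: "z (p k) = of_real (a k) * cis (u k)" for k
  proof -
    have "z (p k) = of_real (cmod (z (p k))) * cis (t (p k))"
      using Arg2pi_eq[of "z (p k)"] by (simp add: t_def cis_conv_exp mult.commute)
    then show ?thesis by (simp add: a_def u_def cis_mult[symmetric])
  qed
  have pm: "p k \<in> {1..n}" for k
    using n unfolding p_def by (intro bij_betw_apply[OF bij]) auto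
  have 1: "(\<Sum>k<n. a k) = 1"
  proof -
    have "(\<Sum>k<n. a k) = (\<Sum>k<n. cmod (z (xs ! k)))" by (simp add: a_def p_def)
    also have "\<dots> = (\<Sum>i\<in>{1..n}. cmod (z i))" by (rule sum.reindex_bij_betw[OF bij])
    finally show ?thesis using assms(1) by (simp add: feasible_def)
  qed
  have 2: "u k \<le> u (Suc k)" if "k < n" for k
  proof (cases "Suc k < n")
    case True
    then have "map t xs ! k \<le> map t xs ! Suc k"
      using xs by (intro sorted_nth_mono) auto
    then show ?thesis using True xs(1) by (simp add: u_def p_def)
  next
    case False
    then have "t (p k) \<le> 2 * pi" "t (p (Suc k)) \<ge> 0"
      using Arg2pi_lt_2pi Arg2pi_ge_0 by (auto simp: t_def less_imp_le)
    then show ?thesis using False that by (simp add: u_def)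
  qed
  have 3: "polygon_defect n
      \<le> triangle_defect (of_real (a k) * cis (u k)) (of_real (a (Suc k)) * cis (u (Suc k)))"
    if "k < n" for k
  proof -
    have "p k \<noteq> p (Suc k)"
      using that n xs(1,2) by (auto simp: p_def nth_eq_iff_index_eq)
    then show ?thesis using d[OF pm pm] by (simp flip: zp)
  qed
  have res: "a k = 1 / n" "u k = u 0 + 2 * pi * k / n" if "k < n" for k
    using cyclic_large_defects[of n a u k] n 1 2 3 that by (auto simp: a_def u_def p_def)
  define P where "P = (\<lambda>j. complex_of_real (1 / n) * cis (u 0 + 2 * pi * real j / real n)) ` {..<n}"
  have reg: "regular_polygon_vertices n P"
    unfolding regular_polygon_vertices_def P_def using n
    by (intro exI[of _ "1 / n"] exI[of _ "u 0"]) auto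
  have "z (xs ! k) = complex_of_real (1 / n) * cis (u 0 + 2 * pi * real k / real n)" if "k < n" for k
    using zp[of k] res[OF that] that by (simp add: p_def)
  then have "P = z ` (!) xs ` {..<n}"
    unfolding P_def image_image by (intro image_cong) auto
  then have im: "z ` {1..n} = P" using bij by (simp add: bij_betw_def)
  have "card P = n"
    unfolding P_def using n inj_on_polygon[of "1 / n" "u 0" n] by (simp add: card_image)
  then have "inj_on z {1..n}" using im by (intro eq_card_imp_inj_on) auto
  then show ?thesis using reg im by (auto simp: bij_betw_def)
qed

section \<open>Regular polygons\<close>

text \<open>Half the angle between two vertices that are \<open>m\<close> steps apart is \<open>\<pi> m / n\<close>, which stays at
  distance at least \<open>\<pi> / n\<close> from all multiples of \<open>\<pi>\<close>. So neighbours have the smallest defect.\<close>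

lemma abs_cos_le_cos_pi_div:
  assumes "1 \<le> m" "m < n"
  shows "\<bar>cos (pi * real m / real n)\<bar> \<le> cos (pi / real n)"
proof -
  have "pi * 1 \<le> pi * real m" "pi * (real m + 1) \<le> pi * real n"
    using assms by (intro mult_left_mono; simp)+
  then have "pi / n \<le> pi * m / n" "(pi * m + pi) / n \<le> pi" "0 < real n"
    using assms by (auto simp: divide_right_mono pos_divide_le_eq distrib_left)
  then have *: "0 \<le> pi / n" "pi / n \<le> pi * m / n" "pi * m / n \<le> pi - pi / n"
    by (auto simp: add_divide_distrib)
  then have "cos (pi * m / n) \<le> cos (pi / n)" "cos (pi - pi * m / n) \<le> cos (pi / n)"
    by (intro cos_monotone_0_pi_le; linarith)+
  then show ?thesis by (simp add: abs_le_iff)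
qed

lemma regular_polygon_defects:
  fixes r \<theta> :: real and n :: nat
  defines "v \<equiv> \<lambda>j::nat. complex_of_real r * cis (\<theta> + 2 * pi * j / n)"
  assumes "r \<ge> 0" "p < n" "q < n" "p \<noteq> q"
  shows "2 * r * (1 - cos (pi / n)) \<le> triangle_defect (v p) (v q)"
proof -
  have key: "2 * r * (1 - cos (pi / n)) \<le> 2 * r * (1 - \<bar>cos (pi * (real q - real p) / n)\<bar>)"
  proof -
    have "\<bar>cos (pi * (real q - real p) / n)\<bar> \<le> cos (pi / n)"
    proof (cases "p < q")
      case True
      then show ?thesis
        using abs_cos_le_cos_pi_div[of "q - p" n] assms by (simp add: of_nat_diff)
    next
      case False
      have "pi * (real q - real p) / n = - (pi * (real p - real q) / n)"
        by (simp add: right_diff_distrib minus_divide_left)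
      then have "cos (pi * (real q - real p) / n) = cos (pi * (real p - real q) / n)"
        by (simp only: cos_minus)
      then show ?thesis
        using False abs_cos_le_cos_pi_div[of "p - q" n] assms by (simp add: of_nat_diff)
    qed
    then show ?thesis using assms by (intro mult_left_mono) auto
  qed
  have "(\<theta> + 2 * pi * q / n - (\<theta> + 2 * pi * p / n)) / 2 = pi * (real q - real p) / n"
    by (simp add: diff_divide_distrib right_diff_distrib)
  then show ?thesis
    using key assms(2) unfolding v_def by (subst triangle_defect_equal_moduli) simp_all
qed

lemma max_value_regular:
  assumes f: "feasible n z" and n: "n \<ge> 2"
    and P: "regular_polygon_vertices n P" "bij_betw z {1..n} P"
  shows "max_value n (n - 2) z = 1 - polygon_defect n"
proof -
  obtain r \<theta> where r: "r > 0"
    and Pdef: "P = (\<lambda>j. complex_of_real r * cis (\<theta> + 2 * pi * real j / real n)) ` {..<n}"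
    using P(1) unfolding regular_polygon_vertices_def by blast
  let ?v = "\<lambda>j::nat. complex_of_real r * cis (\<theta> + 2 * pi * real j / real n)"
  have zv: "\<exists>p<n. z i = ?v p" if "i \<in> {1..n}" for i
    using bij_betwE[OF P(2)] that unfolding Pdef by blast
  have "cmod (z i) = r" if "i \<in> {1..n}" for i
    using zv[OF that] r by (auto simp: norm_mult)
  then have "n * r = 1" using f by (simp add: feasible_def)
  then have "r = 1 / n" using n by (simp add: nonzero_eq_divide_eq mult.commute)
  then have c: "2 * r * (1 - cos (pi / n)) = polygon_defect n"
    by (simp add: polygon_defect_def)
  have ge: "polygon_defect n \<le> triangle_defect (z i) (z j)"
    if ij: "i \<in> {1..n}" "j \<in> {1..n}" "i \<noteq> j" for i j
  proof -
    obtain p q where pq: "p < n" "q < n" "z i = ?v p" "z j = ?v q"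
      using zv ij by meson
    moreover have "z i \<noteq> z j"
      using ij inj_onD[OF bij_betw_imp_inj_on[OF P(2)]] by blast
    ultimately have "p \<noteq> q" by metis
    with regular_polygon_defects[of r p n q \<theta>] r pq(1,2)
    show ?thesis unfolding pq(3,4) c by simp
  qed
  obtain i j where ij: "i \<in> {1..n}" "j \<in> {1..n}" "z i = ?v 0" "z j = ?v 1"
  proof -
    have "?v 0 \<in> P" "?v 1 \<in> P" unfolding Pdef by (intro imageI; use n in simp)+
    then show ?thesis using P(2) that unfolding bij_betw_def by (metis (no_types, lifting) imageE)
  qed
  have "(0::nat) \<in> {..<n}" "1 \<in> {..<n}" using n by auto
  then have "?v 0 \<noteq> ?v 1"
    using inj_onD[OF inj_on_polygon[OF r, of \<theta> n], of 0 1] by (metis zero_neq_one)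
  then have "i \<noteq> j" using ij(3,4) by metis
  have "pi / n \<le> pi / 2" using n by (intro divide_left_mono) auto
  moreover have "0 \<le> pi / n" by simp
  ultimately have "cos (pi / n) \<ge> 0" by (intro cos_ge_zero; linarith)
  then have "triangle_defect (z i) (z j) = polygon_defect n"
    unfolding ij(3,4) using r by (subst triangle_defect_equal_moduli) (auto simp: c)
  then have "1 - v \<le> polygon_defect n" if "max_value n (n - 2) z \<le> v" for v
    using max_value_le_iff[OF f n] that ij(1,2) \<open>i \<noteq> j\<close> by metis
  from this[OF order_refl] show ?thesis
    using max_value_le_iff[OF f n, of "1 - polygon_defect n"] ge by force
qed

lemma ex_regular_feasible:
  assumes n: "n \<ge> 2"
  shows "\<exists>z P. feasible n z \<and> regular_polygon_vertices n P \<and> bij_betw z {1..n} P"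
proof -
  define v where "v j = complex_of_real (1 / n) * cis (0 + 2 * pi * real j / real n)" for j :: nat
  define z where "z k = v (k - 1)" for k
  have bij: "bij_betw (\<lambda>k. k - 1) {1..n} {..<n}"
    by (rule bij_betwI[where g = Suc]) auto
  have inj: "inj_on v {..<n}"
    unfolding v_def using n inj_on_polygon[of "1 / n" 0 n] by simp
  have "bij_betw (v \<circ> (\<lambda>k. k - 1)) {1..n} (v ` {..<n})"
    using bij inj by (intro bij_betw_trans[OF bij] inj_on_imp_bij_betw)
  moreover have "v \<circ> (\<lambda>k. k - 1) = z" by (auto simp: z_def)
  ultimately have "bij_betw z {1..n} (v ` {..<n})" by simp
  moreover have "regular_polygon_vertices n (v ` {..<n})"
    unfolding regular_polygon_vertices_def v_def using n
    by (intro exI[of _ "1 / n"] exI[of _ 0]) auto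
  moreover have "feasible n z"
  proof -
    have "(\<Sum>k=1..n. z k) = (\<Sum>j<n. v j)"
      unfolding z_def by (rule sum.reindex_bij_betw[OF bij])
    also have "\<dots> = of_real (1 / n) * (\<Sum>j<n. cis (2 * pi * real j / real n))"
      by (simp add: v_def sum_distrib_left)
    also have "(\<Sum>j<n. cis (2 * pi * real j / real n)) = \<Sum>{w. w ^ n = 1}"
      using sum.reindex_bij_betw[OF Complex.bij_betw_roots_unity[of n], of "\<lambda>w. w"] n by simp
    also have "\<dots> = 0" using n by (intro sum_roots_unity) simp
    finally show ?thesis using n by (simp add: feasible_def z_def v_def norm_mult norm_divide)
  qed
  ultimately show ?thesis by blast
qed

section \<open>The optimal configurations\<close>

lemma max_value_le_imp_regular:
  assumes "feasible n z" "n \<ge> 2" "max_value n (n - 2) z \<le> 1 - polygon_defect n"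
  shows "\<exists>P. regular_polygon_vertices n P \<and> bij_betw z {1..n} P"
  using assms max_value_le_iff[OF assms(1,2)] by (intro large_defects_imp_regular) auto

text \<open>A configuration strictly below the claimed minimum would satisfy the hypothesis of the uniqueness
  statement and so be a regular \<open>n\<close>-gon, whose value is exactly the claimed minimum.\<close>

lemma pi_max_eq:
  assumes n: "n \<ge> 2"
  shows "pi_max n (n - 2) = 1 - polygon_defect n"
proof -
  obtain w P where w: "feasible n w" "regular_polygon_vertices n P" "bij_betw w {1..n} P"
    using ex_regular_feasible[OF n] by blast
  have lower: "1 - polygon_defect n \<le> max_value n (n - 2) z" if z: "feasible n z" for z
  proof (rule ccontr)
    assume less: "\<not> 1 - polygon_defect n \<le> max_value n (n - 2) z"
    then obtain Q where "regular_polygon_vertices n Q" "bij_betw z {1..n} Q"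
      using max_value_le_imp_regular[OF z n] by auto
    then show False using max_value_regular[OF z n] less by simp
  qed
  show ?thesis
    unfolding pi_max_def
  proof (rule cInf_eq_minimum)
    show "1 - polygon_defect n \<in> max_value n (n - 2) ` {z. feasible n z}"
      using w max_value_regular[OF w(1) n w(2,3)] by force
  qed (use lower in auto)
qed

theorem theorem3p16:
  fixes n :: nat and z :: "nat \<Rightarrow> complex"
  assumes "n \<ge> 4"
    and "feasible n z"
  shows "optimal n (n - 2) z \<longleftrightarrow>
    (\<exists>P. regular_polygon_vertices n P \<and> bij_betw z {1..n} P)"
proof -
  have n: "n \<ge> 2" using assms(1) by simp
  show ?thesis
    unfolding optimal_def pi_max_eq[OF n]
    using assms(2) max_value_le_imp_regular[OF assms(2) n] max_value_regular[OF assms(2) n]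
    by auto
qed

end
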